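(* Let $(G_m)_{m\in\mathbb{Z}}$ be a generalized Fibonacci sequence and let $n\ge 0$ be an integer. Then $$\begin{aligned} \sum_{k=0}^n k^2 G_k G_{n-k} = \frac{1}{150} \Big\{ & \left[ 3n ( 10n^2+25n+13 ) G_0 - (n+1) ( 10n^2+5n-12 ) G_1 \right] G_n \\ & - \left[ (n-1) (10n^2-5n-12) G_0 - 2n ( 10n^2-7 ) G_1 \right] G_{n+1} \Big\}. \end{aligned}$$
   Context: A generalized Fibonacci sequence is a sequence $(G_m)_{m\in\mathbb{Z}}$ of complex numbers with $G_{m+2}=G_{m+1}+G_m$ for all integers $m$ (with arbitrary seed $G_0,G_1$). *)

theory Defs
  imports Complex_Main
begin

definition gen_fib :: "(int \<Rightarrow> complex) \<Rightarrow> bool" where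
  "gen_fib G \<longleftrightarrow> (\<forall>m. G (m + 2) = G (m + 1) + G m)"

end

theory Submission
  imports Defs
begin

text \<open>Splitting \<open>G (n + 2 - k)\<close> by the Fibonacci recurrence turns the weighted self-convolution
  into a solution of an inhomogeneous Fibonacci recurrence whose extra terms come only from the
  indices at the top end. The closed form satisfies the same recurrence, as a polynomial identity in
  \<open>n\<close>, \<open>G 0\<close>, \<open>G 1\<close>, \<open>G n\<close>, \<open>G (n + 1)\<close>.\<close>

lemma gen_fib_weighted_convolution_rec:
  fixes G :: "int \<Rightarrow> complex" and w :: "nat \<Rightarrow> complex" and n :: nat
  assumes "gen_fib G"
  defines "S \<equiv> \<lambda>n. \<Sum>k=0..n. w k * G (int k) * G (int n - int k)"
  shows "S (n + 2) = S (n + 1) + S n + w (n + 1) * G (int n + 1) * (G 1 - G 0)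
           + w (n + 2) * G (int n + 2) * G 0"
proof -
  have split: "G (int n + 2 - int k) = G (int n + 1 - int k) + G (int n - int k)" for k
    using assms(1)[unfolded gen_fib_def, rule_format, of "int n - int k"]
    by (simp add: algebra_simps)
  \<comment> \<open>The term \<open>k = n + 1\<close> is split off so that all sums run over
    \<open>0..n\<close>. Its factor \<open>G 0\<close>, set against the \<open>G 1\<close> it
    carries in \<open>S (n + 2)\<close>, produces the difference \<open>G 1 - G 0\<close>.\<close>
  have 1: "S (n + 1) = (\<Sum>k=0..n. w k * G (int k) * G (int n + 1 - int k))
             + w (n + 1) * G (int n + 1) * G 0"
    by (simp add: S_def algebra_simps)
  have "S (n + 2) = (\<Sum>k=0..n. w k * G (int k) * G (int n + 2 - int k))
             + w (n + 1) * G (int n + 1) * G 1 + w (n + 2) * G (int n + 2) * G 0"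
    by (simp add: S_def numeral_2_eq_2 algebra_simps)
  also have "(\<Sum>k=0..n. w k * G (int k) * G (int n + 2 - int k))
      = (\<Sum>k=0..n. w k * G (int k) * G (int n + 1 - int k)) + S n"
    by (simp add: S_def split distrib_left sum.distrib)
  finally show ?thesis
    using 1 by (simp add: algebra_simps)
qed

theorem mainTheorem11:
  fixes G :: "int \<Rightarrow> complex" and n :: nat
  assumes "gen_fib G"
  shows "(\<Sum>k=0..n. (of_nat k)^2 * G (int k) * G (int n - int k)) =
    (1 / 150) *
      ((3 * of_nat n * (10 * (of_nat n)^2 + 25 * of_nat n + 13) * G 0
          - (of_nat n + 1) * (10 * (of_nat n)^2 + 5 * of_nat n - 12) * G 1) * G (int n)
       - ((of_nat n - 1) * (10 * (of_nat n)^2 - 5 * of_nat n - 12) * G 0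
          - 2 * of_nat n * (10 * (of_nat n)^2 - 7) * G 1) * G (int n + 1))"
proof (induction n rule: induct_nat_012)
  case 0
  show ?case by simp
next
  case 1
  \<comment> \<open>The closed form at 1 contains \<open>G 2\<close>; after this substitution the
    squares of \<open>G 1\<close> cancel and \<open>150 * G 0 * G 1\<close> remains in the
    braces.\<close>
  have "G 2 = G 1 + G 0"
    using assms[unfolded gen_fib_def, rule_format, of 0] by simp
  then show ?case by (simp add: algebra_simps power2_eq_square)
next
  case (ge2 n)
  have G2: "G (int n + 2) = G (int n + 1) + G (int n)"
    using assms by (simp add: gen_fib_def)
  have G3: "G (int n + 3) = 2 * G (int n + 1) + G (int n)"
    using assms[unfolded gen_fib_def, rule_format, of "int n + 1"] G2 by (simp add: ac_simps)
  let ?S = "\<lambda>n. \<Sum>k=0..n. (of_nat k)^2 * G (int k) * G (int n - int k)"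
  let ?x = "of_nat n :: complex"
  have rec: "?S (n + 2) = ?S (n + 1) + ?S n + (?x + 1)^2 * G (int n + 1) * (G 1 - G 0)
      + (?x + 2)^2 * G (int n + 2) * G 0"
    using gen_fib_weighted_convolution_rec[OF assms, of "\<lambda>k. (of_nat k)^2" n]
    by (simp only: of_nat_add of_nat_1 of_nat_numeral)
  \<comment> \<open>With the index and the two sequence values as separate arguments, shifting
    \<open>n\<close> only shifts \<open>x\<close> and replaces \<open>a\<close> and
    \<open>b\<close>.\<close>
  let ?R = "\<lambda>x a b. (1 / 150) *
      ((3 * x * (10 * x^2 + 25 * x + 13) * G 0 - (x + 1) * (10 * x^2 + 5 * x - 12) * G 1) * a
       - ((x - 1) * (10 * x^2 - 5 * x - 12) * G 0 - 2 * x * (10 * x^2 - 7) * G 1) * b)"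
  have IH0: "?S n = ?R ?x (G (int n)) (G (int n + 1))"
    by (rule ge2.IH(1))
  have IH1: "?S (n + 1) = ?R (?x + 1) (G (int n + 1)) (G (int n + 2))"
    using ge2.IH(2) by (simp only: Suc_eq_plus1 of_nat_add of_nat_1 add.assoc one_add_one)
  have "?S (n + 2) = ?R (?x + 2) (G (int n + 2)) (G (int n + 3))"
    \<comment> \<open>Only \<open>?x\<close>, \<open>G 0\<close>, \<open>G 1\<close>,
      \<open>G (int n)\<close> and \<open>G (int n + 1)\<close> remain, and the claim holds
      identically as a polynomial in these.\<close>
    unfolding rec IH0 IH1 G2 G3 by (simp add: field_simps power2_eq_square)
  then show ?case
    by (simp add: ac_simps)
qed

end
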